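(* Let $N,M\ge 1$ be integers, $\sigma>0$ and $|\rho|<1$ real. Let $x_{0n},y_{0n}$ ($1\le n\le N$) and $x_{mn},y_{mn}$ ($2\le m\le M$, $1\le n\le N$) be mutually independent real Gaussian random variables with mean $0$ and variance $1/2$. Define $h_{1n}=\sigma x_{0n}+j\sigma y_{0n}$ and, for $2\le m\le M$, $h_{mn}=\sigma(\sqrt{1-\rho^2}\,x_{mn}+\rho x_{0n})+j\sigma(\sqrt{1-\rho^2}\,y_{mn}+\rho y_{0n})$, where $j$ is the imaginary unit. Let $X_m=\sum_{n=1}^N|h_{mn}|^2$ for $1\le m\le M$. Then for every $z\ge 0$, $$\Pr(X_1\le z,\dots,X_M\le z)=\int_0^z\frac{t_1^{N-1}}{\sigma^{2N}(N-1)!}e^{-\frac{t_1}{\sigma^2}}\left(1-Q_N\!\left(\sqrt{\frac{2\rho^2t_1}{\sigma^2(1-\rho^2)}},\sqrt{\frac{2z}{\sigma^2(1-\rho^2)}}\right)\right)^{M-1}dt_1 .$$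
   Context: For an integer $\nu\ge1$, $Q_\nu$ is the generalized Marcum $Q$-function: for $a>0$, $b\ge0$, $Q_\nu(a,b)=\int_b^\infty x\left(\frac{x}{a}\right)^{\nu-1}e^{-\frac{x^2+a^2}{2}}I_{\nu-1}(ax)\,dx$, where $I_{\nu-1}$ is the modified Bessel function of the first kind, and $Q_\nu(0,b)$ is the limit as $a\to0^+$, i.e. $Q_\nu(0,b)=\frac{1}{(\nu-1)!}\int_{b^2/2}^\infty s^{\nu-1}e^{-s}ds$. *)

theory Defs
  imports "HOL-Probability.Probability"
begin

text \<open>Power series of the modified Bessel function of the first kind.\<close>

definition bessel_I :: "nat \<Rightarrow> real \<Rightarrow> real" where
  "bessel_I n x = (\<Sum>k. (x / 2) ^ (2 * k + n) / (fact k * fact (k + n)))"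

text \<open>Meaningful for \<open>\<nu> \<ge> 1\<close>, \<open>a \<ge> 0\<close> and \<open>b \<ge> 0\<close>. The value at \<open>a = 0\<close> is the limit for \<open>a\<close> tending to \<open>0\<close> from above; the general formula
  cannot be used there because it divides by \<open>a\<close>.\<close>

definition marcum_Q :: "nat \<Rightarrow> real \<Rightarrow> real \<Rightarrow> real" where
  "marcum_Q \<nu> a b =
     (if a = 0
      then 1 / fact (\<nu> - 1) * (LBINT s:{b\<^sup>2 / 2..}. s ^ (\<nu> - 1) * exp (- s))
      else (LBINT x:{b..}. x * (x / a) ^ (\<nu> - 1) * exp (- (x\<^sup>2 + a\<^sup>2) / 2)
                             * bessel_I (\<nu> - 1) (a * x)))"

text \<open>The first index \<open>m\<close> of the channel coefficients ranges over \<open>1, \<dots>, M\<close>, whereas the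
  underlying Gaussian variables \<open>x m n\<close> and \<open>y m n\<close> are only used for \<open>m = 0\<close> and \<open>m \<ge> 2\<close>.\<close>

definition channel ::
  "real \<Rightarrow> real \<Rightarrow> (nat \<Rightarrow> nat \<Rightarrow> 'a \<Rightarrow> real) \<Rightarrow> (nat \<Rightarrow> nat \<Rightarrow> 'a \<Rightarrow> real) \<Rightarrow> nat \<Rightarrow> nat \<Rightarrow> 'a \<Rightarrow> complex"
where
  "channel \<sigma> \<rho> x y m n \<omega> =
     (if m = 1
      then of_real (\<sigma> * x 0 n \<omega>) + \<i> * of_real (\<sigma> * y 0 n \<omega>)
      else of_real (\<sigma> * (sqrt (1 - \<rho>\<^sup>2) * x m n \<omega> + \<rho> * x 0 n \<omega>))
         + \<i> * of_real (\<sigma> * (sqrt (1 - \<rho>\<^sup>2) * y m n \<omega> + \<rho> * y 0 n \<omega>)))"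

definition channel_gain ::
  "nat \<Rightarrow> real \<Rightarrow> real \<Rightarrow> (nat \<Rightarrow> nat \<Rightarrow> 'a \<Rightarrow> real) \<Rightarrow> (nat \<Rightarrow> nat \<Rightarrow> 'a \<Rightarrow> real) \<Rightarrow> nat \<Rightarrow> 'a \<Rightarrow> real"
where
  "channel_gain N \<sigma> \<rho> x y m \<omega> = (\<Sum>n = 1..N. (cmod (channel \<sigma> \<rho> x y m n \<omega>))\<^sup>2)"

end

theory Submission
  imports Defs
begin

text \<open>For \<open>G\<close> normal with mean \<open>0\<close> and variance \<open>1 / 2\<close>, \<open>(G + c)\<^sup>2\<close> is distributed as a
  Poisson mixture (parameter \<open>c\<^sup>2\<close>) of gamma laws of shapes \<open>1 / 2 + k\<close>. Such mixtures are closed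
  under convolution: shapes add by the beta integral and Poisson parameters add by the binomial
  theorem. Hence a sum of \<open>2 N\<close> shifted squares is the mixture with shape \<open>N\<close>, depending on the shifts
  only through the sum of their squares, and expanding the Bessel function in its power series
  identifies its tail with \<open>Q\<^sub>N\<close>. Given the variables with index \<open>m = 0\<close>, the gains \<open>X\<^sub>2, \<dots>, X\<^sub>M\<close>
  are independent with this law, and the shifts enter only through \<open>X\<^sub>1\<close>; it remains to integrate
  against the gamma law of \<open>X\<^sub>1\<close>.\<close>

section \<open>Gamma densities and their Poisson mixtures\<close>

definition gamma_density :: "real \<Rightarrow> real \<Rightarrow> real" where
  "gamma_density s t = (if 0 < t then t powr (s - 1) * exp (- t) / Gamma s else 0)"

text \<open>With \<open>s = d / 2\<close>, this is the density of half a noncentral chi-squared variable with \<open>d\<close> degrees of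
  freedom and noncentrality \<open>2 l\<close>. Values in \<^typ>\<open>ennreal\<close> avoid all summability conditions.\<close>

definition nc_gamma_density :: "real \<Rightarrow> real \<Rightarrow> real \<Rightarrow> ennreal" where
  "nc_gamma_density s l t = (\<Sum>k. ennreal (exp (- l) * l ^ k / fact k) * ennreal (gamma_density (s + real k) t))"

lemma gamma_density_measurable [measurable]: "gamma_density s \<in> borel_measurable borel"
  unfolding gamma_density_def by measurable

lemma gamma_density_nonneg: "0 < s \<Longrightarrow> 0 \<le> gamma_density s t"
  by (auto simp: gamma_density_def intro!: mult_nonneg_nonneg divide_nonneg_nonneg Gamma_real_pos less_imp_le)

lemma nc_gamma_density_measurable [measurable]:
  "case_prod (nc_gamma_density s) \<in> borel_measurable (borel \<Otimes>\<^sub>M borel)"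
  unfolding nc_gamma_density_def case_prod_beta' by measurable

lemma nc_gamma_density_measurable' [measurable]: "nc_gamma_density s l \<in> borel_measurable borel"
  unfolding nc_gamma_density_def by measurable

lemma nn_integral_gamma_density:
  assumes "0 < s" shows "(\<integral>\<^sup>+t. gamma_density s t \<partial>lborel) = 1"
proof -
  have "(\<integral>\<^sup>+t. gamma_density s t \<partial>lborel)
      = (\<integral>\<^sup>+t. ennreal (1 / Gamma s) * ennreal (indicator {0..} t * t powr (s - 1) / exp t) \<partial>lborel)"
    using assms
    by (intro nn_integral_cong_AE AE_I2)
       (auto simp: gamma_density_def indicator_def ennreal_mult'[symmetric] exp_minus field_simps)
  also have "\<dots> = ennreal (1 / Gamma s) * ennreal (Gamma s)"
    by (subst nn_integral_cmult) (simp_all add: Gamma_conv_nn_integral_real[OF assms])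
  also have "\<dots> = 1"
    using Gamma_real_pos[OF assms] by (simp add: ennreal_mult'[symmetric])
  finally show ?thesis .
qed

text \<open>Substituting \<open>y = t * x\<close> pulls all powers of \<open>t\<close> and the
  factor \<open>exp (- t)\<close> out of the integral. What remains is a beta integral, whose value
  in terms of \<open>Gamma\<close> restores the normalisation for shape
  \<open>a + b\<close>.\<close>

lemma gamma_density_convolution:
  assumes a: "0 < a" and b: "0 < b"
  shows "(\<integral>\<^sup>+y. ennreal (gamma_density a (t - y)) * ennreal (gamma_density b y) \<partial>lborel) = gamma_density (a + b) t"
proof (cases "t > 0")
  case False
  then have "\<And>y. ennreal (gamma_density a (t - y)) * ennreal (gamma_density b y) = 0"
    by (auto simp: gamma_density_def)
  then have "(\<integral>\<^sup>+y. ennreal (gamma_density a (t - y)) * ennreal (gamma_density b y) \<partial>lborel) = 0"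
    by (simp only: nn_integral_const mult_zero_left)
  then show ?thesis using False by (simp add: gamma_density_def)
next
  case True
  define f where "f x = x powr (b - 1) * (1 - x) powr (a - 1)" for x :: real
  have pos: "Gamma a > 0" "Gamma b > 0" "Gamma (a + b) > 0" using a b by (auto intro: Gamma_real_pos)
  have Beta: "(\<integral>\<^sup>+x. ennreal (indicator {0..1} x * f x) \<partial>lborel) = Beta b a"
    using nn_integral_has_integral_lebesgue[OF _ has_integral_Beta_real[OF b a]] by (simp add: f_def)
  have "(\<integral>\<^sup>+y. ennreal (gamma_density a (t - y)) * ennreal (gamma_density b y) \<partial>lborel)
     = t * (\<integral>\<^sup>+x. ennreal (gamma_density a (t - (0 + t * x))) * ennreal (gamma_density b (0 + t * x)) \<partial>lborel)"
    using True by (subst nn_integral_real_affine[where c=t and t=0]) auto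
  also have "(\<integral>\<^sup>+x. ennreal (gamma_density a (t - (0 + t * x))) * ennreal (gamma_density b (0 + t * x)) \<partial>lborel)
     = (\<integral>\<^sup>+x. ennreal (t powr (a + b - 2) * exp (-t) / (Gamma a * Gamma b)) * ennreal (indicator {0..1} x * f x) \<partial>lborel)"
  \<comment> \<open>Off the null set of the two endpoints, either \<open>x\<close> lies inside the
    unit interval or one of the two densities has a negative argument and vanishes.\<close>
  proof (intro nn_integral_cong_AE eventually_mono[OF AE_conjI[OF AE_lborel_singleton[of 0] AE_lborel_singleton[of 1]]])
    fix x :: real assume x: "x \<noteq> 0 \<and> x \<noteq> 1"
    show "ennreal (gamma_density a (t - (0 + t * x))) * ennreal (gamma_density b (0 + t * x))
      = ennreal (t powr (a + b - 2) * exp (-t) / (Gamma a * Gamma b)) * ennreal (indicator {0..1} x * f x)"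
    proof (cases "0 < x \<and> x < 1")
      case True
      with \<open>t > 0\<close> have *: "t - t * x = t * (1 - x)" "0 < t * x" "0 < t * (1 - x)"
        by (auto simp: algebra_simps)
      have e: "exp (- t) = exp (- (t * (1 - x))) * exp (- (t * x))"
        by (simp add: exp_add[symmetric] algebra_simps)
      have p: "t powr (a + b - 2) = t powr (a - 1) * t powr (b - 1)"
        by (simp add: powr_add[symmetric] algebra_simps)
      have "gamma_density a (t - (0 + t * x)) = t powr (a - 1) * (1 - x) powr (a - 1) * exp (- (t * (1 - x))) / Gamma a"
        using True \<open>t > 0\<close> by (simp only: gamma_density_def * add_0_left) (simp add: powr_mult)
      moreover have "gamma_density b (0 + t * x) = t powr (b - 1) * x powr (b - 1) * exp (- (t * x)) / Gamma b"
        using True \<open>t > 0\<close> by (simp add: gamma_density_def powr_mult)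
      ultimately have "gamma_density a (t - (0 + t * x)) * gamma_density b (0 + t * x)
        = t powr (a + b - 2) * exp (-t) / (Gamma a * Gamma b) * (indicator {0..1} x * f x)"
        using True unfolding e p f_def by simp
      then show ?thesis
        using pos by (simp add: ennreal_mult'[symmetric] gamma_density_nonneg a)
    next
      case False
      then have "x < 0 \<or> x > 1" using x by auto
      then show ?thesis
      proof
        assume "x < 0" then have "t * x < 0" using \<open>t > 0\<close> by (simp add: mult_pos_neg)
        then show ?thesis using \<open>x < 0\<close> by (simp add: gamma_density_def)
      next
        assume "x > 1" then have "t * x > t" using \<open>t > 0\<close> by simp
        then show ?thesis using \<open>x > 1\<close> by (simp add: gamma_density_def)
      qed
    qed
  qed
  also have "t * \<dots> = ennreal (t * (t powr (a + b - 2) * exp (-t) / (Gamma a * Gamma b)) * Beta b a)"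
    using True pos
    by (subst nn_integral_cmult) (simp_all add: f_def, simp add: Beta[unfolded f_def] ennreal_mult'[symmetric] mult.assoc)
  also have "t * (t powr (a + b - 2) * exp (-t) / (Gamma a * Gamma b)) * Beta b a = gamma_density (a + b) t"
  proof -
    have "t powr (a + b - 1) = t * t powr (a + b - 2)"
      using True by (simp add: powr_mult_base)
    then show ?thesis using True pos by (simp add: gamma_density_def Beta_def add.commute)
  qed
  finally show ?thesis .
qed

text \<open>Grouping by the sum of the indices is a rearrangement of nonnegative terms: Tonelli for
  the counting measure allows the interchange.\<close>

lemma suminf_product_diagonal_ennreal:
  fixes f :: "nat \<Rightarrow> nat \<Rightarrow> ennreal"
  shows "(\<Sum>i. \<Sum>j. f i j) = (\<Sum>n. \<Sum>i\<le>n. f i (n - i))"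
proof -
  \<comment> \<open>Padding with zeros for \<open>n < i\<close> lets the shifted inner series range
    over all naturals, so that the two sums can be swapped.\<close>
  define g where "g i n = (if i \<le> n then f i (n - i) else 0)" for i n
  have "(\<Sum>j. f i j) = (\<Sum>n. g i n)" for i
    using suminf_offset[of "g i" i] by (simp add: g_def[abs_def])
  then have "(\<Sum>i. \<Sum>j. f i j) = (\<Sum>i. \<Sum>n. g i n)" by simp
  also have "\<dots> = (\<Sum>n. \<Sum>i. g i n)"
    using nn_integral_suminf[of "\<lambda>n i. g i n" "count_space UNIV"] by (simp add: nn_integral_count_space_nat)
  also have "\<dots> = (\<Sum>n. \<Sum>i\<le>n. f i (n - i))"
    by (intro suminf_cong, subst suminf_finite[of "{..n}" for n]) (auto simp: g_def)
  finally show ?thesis .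
qed

lemma suminf_mult_suminf_ennreal:
  fixes f g :: "nat \<Rightarrow> ennreal"
  shows "(\<Sum>i. f i) * (\<Sum>j. g j) = (\<Sum>i. \<Sum>j. f i * g j)"
  by simp

text \<open>This is the binomial theorem. For nonnegative parameters it expresses that a sum of
  independent Poisson variables is Poisson.\<close>

lemma poisson_weights_convolution:
  fixes l l' :: real
  shows "(\<Sum>i\<le>n. (exp (- l) * l ^ i / fact i) * (exp (- l') * l' ^ (n - i) / fact (n - i)))
    = exp (- (l + l')) * (l + l') ^ n / fact n"
proof -
  have "(\<Sum>i\<le>n. (exp (- l) * l ^ i / fact i) * (exp (- l') * l' ^ (n - i) / fact (n - i)))
    = exp (- (l + l')) / fact n * (\<Sum>i\<le>n. of_nat (n choose i) * l ^ i * l' ^ (n - i))"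
    unfolding sum_distrib_left
    by (intro sum.cong refl) (simp add: binomial_fact exp_add[symmetric] mult_exp_exp field_simps)
  also have "(\<Sum>i\<le>n. of_nat (n choose i) * l ^ i * l' ^ (n - i)) = (l + l') ^ n"
    by (simp add: binomial_ring)
  finally show ?thesis by simp
qed

text \<open>Convolving the \<open>i\<close>-th component of one mixture with the \<open>j\<close>-th
  of the other gives shape \<open>s + s' + (i + j)\<close>, which depends on the indices only
  through their sum. Grouping along diagonals therefore leaves just the convolved Poisson
  weights.\<close>

lemma nc_gamma_density_convolution:
  assumes s: "0 < s" "0 < s'" and l: "0 \<le> l" "0 \<le> l'"
  shows "(\<integral>\<^sup>+y. nc_gamma_density s l (t - y) * nc_gamma_density s' l' y \<partial>lborel) = nc_gamma_density (s + s') (l + l') t"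
proof -
  define w where "w l k = exp (- l) * l ^ k / fact k" for l :: real and k :: nat
  have w: "0 \<le> w l k" "0 \<le> w l' k" for k using l by (auto simp: w_def)
  let ?g = "gamma_density"
  have "(\<integral>\<^sup>+y. nc_gamma_density s l (t - y) * nc_gamma_density s' l' y \<partial>lborel)
    = (\<integral>\<^sup>+y. (\<Sum>i. \<Sum>j. (ennreal (w l i) * ennreal (w l' j)) * (ennreal (?g (s + i) (t - y)) * ennreal (?g (s' + j) y))) \<partial>lborel)"
    unfolding nc_gamma_density_def w_def[symmetric]
    by (simp only: suminf_mult_suminf_ennreal) (simp only: mult_ac)
  also have "\<dots> = (\<Sum>i. \<Sum>j. (ennreal (w l i) * ennreal (w l' j)) * ennreal (?g ((s + i) + (s' + j)) t))"
    using s by (simp add: nn_integral_suminf nn_integral_cmult gamma_density_convolution)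
  also have "\<dots> = (\<Sum>n. \<Sum>i\<le>n. (ennreal (w l i) * ennreal (w l' (n - i))) * ennreal (?g ((s + i) + (s' + (n - i))) t))"
    by (rule suminf_product_diagonal_ennreal)
  also have "\<dots> = (\<Sum>n. \<Sum>i\<le>n. ennreal (w l i * w l' (n - i)) * ennreal (?g ((s + s') + n) t))"
    using w by (intro suminf_cong sum.cong refl) (simp add: ennreal_mult add_ac of_nat_diff)
  also have "\<dots> = (\<Sum>n. ennreal (w (l + l') n) * ennreal (?g ((s + s') + n) t))"
    using w by (simp add: sum_distrib_right[symmetric] sum_ennreal poisson_weights_convolution[where l=l and l'=l', folded w_def])
  finally show ?thesis unfolding nc_gamma_density_def w_def .
qed

lemma nc_gamma_density_0: "nc_gamma_density s 0 t = gamma_density s t"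
  unfolding nc_gamma_density_def by (subst suminf_finite[of "{0}"]) auto

lemma nn_integral_nc_gamma_density:
  assumes "0 < s" "0 \<le> l"
  shows "(\<integral>\<^sup>+t. nc_gamma_density s l t \<partial>lborel) = 1"
proof -
  have "(\<lambda>k. exp (- l) * (l ^ k / fact k)) sums (exp (- l) * exp l)"
    using exp_converges[of l] by (intro sums_mult) (simp add: divide_inverse mult.commute)
  then have *: "(\<lambda>k. exp (- l) * l ^ k / fact k) sums 1" by (simp add: exp_minus)
  have "(\<integral>\<^sup>+t. nc_gamma_density s l t \<partial>lborel) = (\<Sum>k. ennreal (exp (- l) * l ^ k / fact k))"
    using assms unfolding nc_gamma_density_def
    by (simp add: nn_integral_suminf nn_integral_cmult nn_integral_gamma_density)
  also have "\<dots> = ennreal 1" using assms by (intro suminf_ennreal_eq[OF _ *]) simp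
  finally show ?thesis by simp
qed

section \<open>Squares of shifted normal variables\<close>

text \<open>The values of \<open>Gamma\<close> at \<open>1 / 2 + k\<close> are multiples of
  \<open>pochhammer (1 / 2) k\<close>, and together with \<open>fact k\<close> and
  \<open>4 ^ k\<close> this yields \<open>fact (2 * k)\<close>. The mixture thus becomes the even
  part of an exponential series, which sums to \<open>cosh\<close>.\<close>

lemma nc_gamma_density_half:
  "nc_gamma_density (1 / 2) (c\<^sup>2) t =
    ennreal (if 0 < t then exp (- c\<^sup>2 - t) * cosh (2 * c * sqrt t) / sqrt (pi * t) else 0)"
proof (cases "0 < t")
  case False
  then show ?thesis by (simp add: nc_gamma_density_def gamma_density_def)
next
  case True
  define A where "A = exp (- c\<^sup>2 - t) / sqrt (pi * t)"
  have term_eq: "exp (- c\<^sup>2) * (c\<^sup>2) ^ k / fact k * gamma_density (1 / 2 + real k) t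
    = A * ((2 * c * sqrt t) ^ (2 * k) / fact (2 * k))" for k
  proof -
    have "Gamma (1 / 2 + real k) = sqrt pi * pochhammer (1 / 2) k"
      using pochhammer_Gamma[of "1/2 :: real" k] nonpos_Ints_nonpos[of "1/2 :: real"]
      by (fastforce simp: Gamma_one_half_real field_simps)
    moreover have "(fact (2 * k) :: real) = 4 ^ k * pochhammer (1 / 2) k * fact k"
      using fact_double[of k, where 'a=real] by (simp add: power_mult)
    moreover have "(2 * c * sqrt t) ^ (2 * k) = 4 ^ k * (c\<^sup>2) ^ k * t ^ k"
      using True by (simp add: power_mult power_mult_distrib)
    moreover have "t powr (1 / 2 + real k - 1) = t ^ k / sqrt t"
    proof -
      have "1 / 2 + real k - 1 = real k - 1 / 2" by simp
      then show ?thesis using True by (simp only: powr_diff powr_realpow powr_half_sqrt less_imp_le)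
    qed
    moreover have "pochhammer (1 / 2 :: real) k > 0" by (simp add: pochhammer_pos)
    ultimately show ?thesis
      using True by (simp add: gamma_density_def A_def exp_diff exp_minus real_sqrt_mult field_simps)
  qed
  have "(\<lambda>k. (2 * c * sqrt t) ^ (2 * k) / fact (2 * k)) sums cosh (2 * c * sqrt t)"
  proof -
    \<comment> \<open>The series of \<open>cosh\<close> over all exponents, with zeros at the odd
      ones; reindexing along the even numbers deletes these zeros.\<close>
    define f where "f n = (if even n then (2 * c * sqrt t) ^ n /\<^sub>R fact n else 0)" for n
    have "f n = 0" if "n \<notin> range (\<lambda>k. 2 * k)" for n
      using that by (auto simp: f_def elim!: evenE)
    moreover have "f sums cosh (2 * c * sqrt t)"
      unfolding f_def by (rule cosh_converges)
    ultimately have "(\<lambda>k. f (2 * k)) sums cosh (2 * c * sqrt t)"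
      by (subst sums_mono_reindex) (auto simp: strict_mono_def)
    then show ?thesis by (simp add: f_def divide_inverse mult.commute)
  qed
  then have sums: "(\<lambda>k. exp (- c\<^sup>2) * (c\<^sup>2) ^ k / fact k * gamma_density (1 / 2 + real k) t) sums (A * cosh (2 * c * sqrt t))"
    unfolding term_eq by (rule sums_mult)
  have "nc_gamma_density (1 / 2) (c\<^sup>2) t
    = (\<Sum>k. ennreal (exp (- c\<^sup>2) * (c\<^sup>2) ^ k / fact k * gamma_density (1 / 2 + real k) t))"
    unfolding nc_gamma_density_def
    by (intro suminf_cong ennreal_mult[symmetric] gamma_density_nonneg) simp_all
  also have "\<dots> = ennreal (A * cosh (2 * c * sqrt t))"
    by (intro suminf_ennreal_eq[OF _ sums] mult_nonneg_nonneg gamma_density_nonneg) simp_all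
  finally show ?thesis using True by (simp add: A_def)
qed

text \<open>Both square roots of \<open>t\<close> contribute. After substituting
  \<open>t = x\<^sup>2\<close>, the two exponentials in \<open>cosh\<close> become normal densities
  at \<open>x - c\<close> and \<open>- x - c\<close>; reflecting the second one covers the negative
  half of the interval.\<close>

lemma nn_integral_nc_gamma_density_atMost_half:
  assumes "0 \<le> a"
  shows "(\<integral>\<^sup>+t. nc_gamma_density (1 / 2) (c\<^sup>2) t * indicator {..a} t \<partial>lborel)
    = (\<integral>\<^sup>+x. normal_density 0 (sqrt (1 / 2)) (x - c) * indicator {- sqrt a..sqrt a} x \<partial>lborel)"
proof -
  let ?\<phi> = "normal_density 0 (sqrt (1 / 2))"
  define h where "h t = (if 0 < t then exp (- c\<^sup>2 - t) * cosh (2 * c * sqrt t) / sqrt (pi * t) else 0)" for t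
  have [measurable]: "h \<in> borel_measurable borel" unfolding h_def cosh_def by measurable
  have h: "h (x\<^sup>2) * (2 * x) = ?\<phi> (x - c) + ?\<phi> (- x - c)" if "0 < x" for x
  proof -
    have \<phi>: "?\<phi> y = exp (- y\<^sup>2) / sqrt pi" for y by (simp add: normal_density_def)
    have "exp (- (x - c)\<^sup>2) = exp (- c\<^sup>2 - x\<^sup>2) * exp (2 * c * x)"
      "exp (- (- x - c)\<^sup>2) = exp (- c\<^sup>2 - x\<^sup>2) * exp (- (2 * c * x))"
      by (simp_all add: mult_exp_exp power2_eq_square algebra_simps)
    moreover have "h (x\<^sup>2) * (2 * x) = exp (- c\<^sup>2 - x\<^sup>2) * (exp (2 * c * x) + exp (- (2 * c * x))) / sqrt pi"
      using that by (simp add: h_def cosh_def real_sqrt_mult)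
    ultimately show ?thesis unfolding \<phi> by (simp add: distrib_left add_divide_distrib)
  qed
  \<comment> \<open>The density vanishes for \<open>t \<le> 0\<close>, so the half-line may be cut
    at 0. The endpoints are written as squares to fit the substitution rule.\<close>
  have "(\<integral>\<^sup>+t. nc_gamma_density (1 / 2) (c\<^sup>2) t * indicator {..a} t \<partial>lborel)
     = (\<integral>\<^sup>+t. h t * indicator {0\<^sup>2..(sqrt a)\<^sup>2} t \<partial>lborel)"
    using assms by (intro nn_integral_cong) (auto simp: nc_gamma_density_half h_def indicator_def)
  also have "\<dots> = (\<integral>\<^sup>+x. h (x\<^sup>2) * (2 * x) * indicator {0..sqrt a} x \<partial>lborel)"
    using assms by (intro nn_integral_substitution)
      (auto simp: set_borel_measurable_def intro!: derivative_eq_intros continuous_intros)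
  \<comment> \<open>At \<open>x = 0\<close> the left side is 0 while the right side is positive,
    hence equality only almost everywhere.\<close>
  also have "\<dots> = (\<integral>\<^sup>+x. ennreal (?\<phi> (x - c) * indicator {0..sqrt a} x) + ennreal (?\<phi> (- x - c) * indicator {0..sqrt a} x) \<partial>lborel)"
    by (intro nn_integral_cong_AE eventually_mono[OF AE_lborel_singleton[of 0]])
       (auto simp: h indicator_def ennreal_plus[symmetric] simp del: ennreal_plus)
  also have "\<dots> = (\<integral>\<^sup>+x. ?\<phi> (x - c) * indicator {0..sqrt a} x \<partial>lborel) + (\<integral>\<^sup>+x. ?\<phi> (- x - c) * indicator {0..sqrt a} x \<partial>lborel)"
    by (intro nn_integral_add) auto
  also have "(\<integral>\<^sup>+x. ?\<phi> (- x - c) * indicator {0..sqrt a} x \<partial>lborel) = (\<integral>\<^sup>+x. ?\<phi> (x - c) * indicator {- sqrt a..0} x \<partial>lborel)"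
    by (subst (2) nn_integral_real_affine[where c="-1" and t=0])
       (auto intro!: nn_integral_cong simp: indicator_def)
  also have "(\<integral>\<^sup>+x. ?\<phi> (x - c) * indicator {0..sqrt a} x \<partial>lborel) + \<dots>
    = (\<integral>\<^sup>+x. ennreal (?\<phi> (x - c) * indicator {0..sqrt a} x) + ennreal (?\<phi> (x - c) * indicator {- sqrt a..0} x) \<partial>lborel)"
    by (intro nn_integral_add[symmetric]) auto
  also have "\<dots> = (\<integral>\<^sup>+x. ?\<phi> (x - c) * indicator {- sqrt a..sqrt a} x \<partial>lborel)"
    using assms by (intro nn_integral_cong_AE eventually_mono[OF AE_lborel_singleton[of 0]])
      (auto simp: indicator_def intro: order_trans)
  finally show ?thesis .
qed

text \<open>It suffices to compare distribution functions. For \<open>a \<ge> 0\<close> the event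
  that the square is at most \<open>a\<close> confines \<open>X\<close> to an interval; for
  \<open>a < 0\<close> both sides are 0.\<close>

lemma (in prob_space) distributed_normal_shift_square:
  assumes X: "distributed M lborel X (normal_density 0 (sqrt (1 / 2)))"
  shows "distributed M lborel (\<lambda>\<omega>. (X \<omega> + c)\<^sup>2) (nc_gamma_density (1 / 2) (c\<^sup>2))"
proof -
  let ?\<phi> = "normal_density 0 (sqrt (1 / 2))"
  have [measurable]: "X \<in> borel_measurable M" using distributed_measurable[OF X] by simp
  define h where "h t = (if 0 < t then exp (- c\<^sup>2 - t) * cosh (2 * c * sqrt t) / sqrt (pi * t) else 0)" for t
  have [measurable]: "h \<in> borel_measurable borel" unfolding h_def cosh_def by measurable
  have eq: "nc_gamma_density (1 / 2) (c\<^sup>2) = (\<lambda>t. ennreal (h t))"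
    by (auto simp: nc_gamma_density_half h_def)
  have cdf: "emeasure M {\<omega> \<in> space M. (X \<omega> + c)\<^sup>2 \<le> a} = (\<integral>\<^sup>+t. ennreal (h t) * indicator {..a} t \<partial>lborel)" for a
  proof (cases "0 \<le> a")
    case True
    have "{\<omega> \<in> space M. (X \<omega> + c)\<^sup>2 \<le> a} = X -` {- sqrt a - c..sqrt a - c} \<inter> space M"
    proof -
      have "(y + c)\<^sup>2 \<le> a \<longleftrightarrow> \<bar>y + c\<bar> \<le> sqrt a" for y
        using real_sqrt_le_iff[of "(y + c)\<^sup>2" a] by simp
      moreover have "\<bar>y + c\<bar> \<le> sqrt a \<longleftrightarrow> y \<in> {- sqrt a - c..sqrt a - c}" for y
        unfolding atLeastAtMost_iff by linarith
      ultimately show ?thesis by blast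
    qed
    then have "emeasure M {\<omega> \<in> space M. (X \<omega> + c)\<^sup>2 \<le> a} = (\<integral>\<^sup>+x. ?\<phi> x * indicator {- sqrt a - c..sqrt a - c} x \<partial>lborel)"
      by (simp add: distributed_emeasure[OF X]) (auto intro!: nn_integral_cong simp: indicator_def)
    also have "\<dots> = (\<integral>\<^sup>+x. ?\<phi> (x - c) * indicator {- sqrt a..sqrt a} x \<partial>lborel)"
      by (subst nn_integral_real_affine[where c=1 and t="-c"])
         (auto intro!: nn_integral_cong simp: indicator_def)
    finally show ?thesis
      using nn_integral_nc_gamma_density_atMost_half[OF True, of c] by (simp add: eq)
  next
    case False
    then have "{\<omega> \<in> space M. (X \<omega> + c)\<^sup>2 \<le> a} = {}"
      by (auto simp: not_le intro: order_less_le_trans)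
    moreover have "(\<lambda>t. ennreal (h t) * indicator {..a} t) = (\<lambda>t. 0)"
      using False by (auto simp: h_def indicator_def)
    ultimately show ?thesis by (simp only: emeasure_empty nn_integral_const mult_zero_left)
  qed
  have "(\<integral>\<^sup>+t. ennreal (h t * indicator {..a} t) \<partial>lborel) = ennreal (prob {\<omega> \<in> space M. (X \<omega> + c)\<^sup>2 \<le> a})" for a
    using cdf[of a] by (simp add: emeasure_eq_measure ennreal_mult'' ennreal_indicator)
  moreover have "0 \<le> h t" for t by (simp add: h_def)
  ultimately show ?thesis
    unfolding eq
    by (intro distributedI_borel_atMost[where g="\<lambda>a. prob {\<omega> \<in> space M. (X \<omega> + c)\<^sup>2 \<le> a}"])
       (auto simp: emeasure_eq_measure)
qed

text \<open>Each square contributes shape \<open>1 / 2\<close> and Poisson parameter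
  \<open>(c j)\<^sup>2\<close>, and convolution adds both. Only the sum of the squared shifts
  survives, which later reduces conditioning on a whole row of variables to conditioning on one real
  number.\<close>

lemma (in prob_space) distributed_sum_normal_shift_square:
  assumes "finite J" "J \<noteq> {}" "indep_vars (\<lambda>_. borel) X J"
    and "\<And>j. j \<in> J \<Longrightarrow> distributed M lborel (X j) (normal_density 0 (sqrt (1 / 2)))"
  shows "distributed M lborel (\<lambda>\<omega>. \<Sum>j\<in>J. (X j \<omega> + c j)\<^sup>2) (nc_gamma_density (real (card J) / 2) (\<Sum>j\<in>J. (c j)\<^sup>2))"
  using assms
proof (induction rule: finite_ne_induct)
  case (singleton j)
  then show ?case using distributed_normal_shift_square[of "X j" "c j"] by simp
next
  case (insert j J)
  have indep: "indep_vars (\<lambda>_. borel) (\<lambda>j \<omega>. (X j \<omega> + c j)\<^sup>2) (insert j J)"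
    using insert.prems(1) by (rule indep_vars_compose2) simp
  have "indep_vars (\<lambda>_. borel) X J" using insert.prems(1) by (rule indep_vars_subset) auto
  then have IH: "distributed M lborel (\<lambda>\<omega>. \<Sum>j\<in>J. (X j \<omega> + c j)\<^sup>2) (nc_gamma_density (real (card J) / 2) (\<Sum>j\<in>J. (c j)\<^sup>2))"
    using insert by auto
  have pos: "0 < real (card J) / 2" using insert by (simp add: card_gt_0_iff)
  have *: "nc_gamma_density (1 / 2 + real (card J) / 2) ((c j)\<^sup>2 + (\<Sum>j\<in>J. (c j)\<^sup>2))
     = (\<lambda>t. \<integral>\<^sup>+y. nc_gamma_density (1 / 2) ((c j)\<^sup>2) (t - y) * nc_gamma_density (real (card J) / 2) (\<Sum>j\<in>J. (c j)\<^sup>2) y \<partial>lborel)"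
    using pos by (intro ext nc_gamma_density_convolution[symmetric]) (auto intro: sum_nonneg)
  have "distributed M lborel (\<lambda>\<omega>. (X j \<omega> + c j)\<^sup>2 + (\<Sum>j\<in>J. (X j \<omega> + c j)\<^sup>2))
      (nc_gamma_density (1 / 2 + real (card J) / 2) ((c j)\<^sup>2 + (\<Sum>j\<in>J. (c j)\<^sup>2)))"
    unfolding * using insert
    by (intro distributed_convolution indep_vars_sum[OF _ _ indep] IH distributed_normal_shift_square) auto
  then show ?case using insert by (simp add: add_divide_distrib)
qed

section \<open>The Marcum function as a tail probability\<close>

lemma summable_power_over_facts:
  fixes y :: real
  shows "summable (\<lambda>k. y ^ k / (fact k * fact (k + n)))"
proof (rule summable_comparison_test'[of "\<lambda>k. \<bar>y\<bar> ^ k / fact k" 0])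
  show "summable (\<lambda>k. \<bar>y\<bar> ^ k / fact k)"
    using summable_exp[of "\<bar>y\<bar>"] by (simp add: divide_inverse mult.commute)
  show "norm (y ^ k / (fact k * fact (k + n))) \<le> \<bar>y\<bar> ^ k / fact k" for k
  proof -
    have "(fact k :: real) * 1 \<le> fact k * fact (k + n)"
      by (intro mult_left_mono fact_ge_1) simp
    then show ?thesis by (simp add: power_abs frac_le)
  qed
qed

text \<open>Real-valued form of the mixture at shape \<open>n + 1\<close>, so that \<open>n\<close>
  is the order of the Bessel function. For positive \<open>l\<close> and \<open>t\<close> it equals
  \<open>(t / l) powr (n / 2) * exp (- (t + l)) * bessel_I n (2 * sqrt (l * t))\<close>; keeping the
  series avoids the division by \<open>l\<close> and covers \<open>l = 0\<close>.\<close>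

definition nc_erlang_density :: "nat \<Rightarrow> real \<Rightarrow> real \<Rightarrow> real" where
  "nc_erlang_density n l t =
     (if 0 < t then t ^ n * exp (- (t + l)) * (\<Sum>k. (l * t) ^ k / (fact k * fact (k + n))) else 0)"

lemma nc_erlang_density_measurable [measurable]: "nc_erlang_density n l \<in> borel_measurable borel"
  unfolding nc_erlang_density_def by measurable

lemma nc_erlang_density_nonneg: "0 \<le> l \<Longrightarrow> 0 \<le> nc_erlang_density n l t"
  by (auto simp: nc_erlang_density_def intro!: mult_nonneg_nonneg suminf_nonneg summable_power_over_facts)

text \<open>At integer shape the values of \<open>Gamma\<close> are the factorials
  \<open>fact (k + n)\<close> of the Bessel series.\<close>

lemma nc_gamma_density_Suc:
  assumes "0 \<le> l"
  shows "nc_gamma_density (real (Suc n)) l t = ennreal (nc_erlang_density n l t)"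
proof (cases "0 < t")
  case False
  then show ?thesis by (simp add: nc_gamma_density_def gamma_density_def nc_erlang_density_def)
next
  case True
  have "(\<lambda>k. t ^ n * exp (- (t + l)) * ((l * t) ^ k / (fact k * fact (k + n)))) sums nc_erlang_density n l t"
    using True unfolding nc_erlang_density_def by (simp only: if_True) (intro sums_mult summable_sums summable_power_over_facts)
  moreover have "exp (- l) * l ^ k / fact k * gamma_density (real (Suc n) + real k) t
      = t ^ n * exp (- (t + l)) * ((l * t) ^ k / (fact k * fact (k + n)))" for k
  proof -
    have "Gamma (real (Suc n) + real k) = fact (k + n)"
      using Gamma_fact[of "k + n", where 'a=real] by (simp add: add_ac)
    moreover have "t powr (real (Suc n) + real k - 1) = t ^ (n + k)"
      using True by (simp add: powr_realpow[symmetric])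
    ultimately show ?thesis
      using True by (simp add: gamma_density_def power_add power_mult_distrib exp_add[symmetric] mult_exp_exp)
  qed
  ultimately have sums: "(\<lambda>k. exp (- l) * l ^ k / fact k * gamma_density (real (Suc n) + real k) t) sums nc_erlang_density n l t"
    by simp
  have "nc_gamma_density (real (Suc n)) l t
    = (\<Sum>k. ennreal (exp (- l) * l ^ k / fact k * gamma_density (real (Suc n) + real k) t))"
    unfolding nc_gamma_density_def using assms
    by (intro suminf_cong ennreal_mult[symmetric] gamma_density_nonneg) simp_all
  also have "\<dots> = ennreal (nc_erlang_density n l t)"
    using assms by (intro suminf_ennreal_eq[OF _ sums] mult_nonneg_nonneg gamma_density_nonneg) simp_all
  finally show ?thesis .
qed

lemma integrable_nc_erlang_density:
  assumes "0 \<le> l"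
  shows "integrable lborel (nc_erlang_density n l)"
  using nn_integral_nc_gamma_density[of "real (Suc n)" l] assms
  by (intro integrableI_nn_integral_finite[where x=1]) (auto simp: nc_gamma_density_Suc nc_erlang_density_nonneg simp del: of_nat_Suc)

text \<open>The powers of \<open>a\<close> in \<open>(x / a) ^ n\<close> and in the leading factor
  \<open>(a * x / 2) ^ n\<close> of the Bessel series cancel, leaving
  \<open>(x\<^sup>2 / 2) ^ n\<close>. The remaining factor \<open>x\<close> is the derivative of
  \<open>x\<^sup>2 / 2\<close>, ready for a change of variables.\<close>

lemma marcum_integrand_eq:
  assumes a: "0 < a" and x: "0 \<le> x"
  shows "x * (x / a) ^ n * exp (- (x\<^sup>2 + a\<^sup>2) / 2) * bessel_I n (a * x) = x * nc_erlang_density n (a\<^sup>2 / 2) (x\<^sup>2 / 2)"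
proof (cases "x = 0")
  case False
  then have "0 < x" using x by simp
  have "(\<lambda>k. (a * x / 2) ^ n * ((a\<^sup>2 / 2 * (x\<^sup>2 / 2)) ^ k / (fact k * fact (k + n)))) sums
    ((a * x / 2) ^ n * (\<Sum>k. (a\<^sup>2 / 2 * (x\<^sup>2 / 2)) ^ k / (fact k * fact (k + n))))"
    by (intro sums_mult summable_sums summable_power_over_facts)
  moreover have "(a * x / 2) ^ n * ((a\<^sup>2 / 2 * (x\<^sup>2 / 2)) ^ k / (fact k * fact (k + n)))
     = (a * x / 2) ^ (2 * k + n) / (fact k * fact (k + n))" for k
  proof -
    have "(a * x / 2)\<^sup>2 = a\<^sup>2 / 2 * (x\<^sup>2 / 2)" by (simp add: power2_eq_square)
    then have "(a * x / 2) ^ (2 * k + n) = (a * x / 2) ^ n * (a\<^sup>2 / 2 * (x\<^sup>2 / 2)) ^ k"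
      by (simp only: power_add power_mult mult.commute[of "_ ^ n"])
    then show ?thesis by simp
  qed
  ultimately have I: "bessel_I n (a * x) = (a * x / 2) ^ n * (\<Sum>k. (a\<^sup>2 / 2 * (x\<^sup>2 / 2)) ^ k / (fact k * fact (k + n)))"
    unfolding bessel_I_def by (simp add: sums_iff)
  have p: "(x / a) ^ n * (a * x / 2) ^ n = (x\<^sup>2 / 2) ^ n"
    unfolding power_mult_distrib[symmetric] using a by (simp add: power2_eq_square)
  have e: "- (x\<^sup>2 + a\<^sup>2) / 2 = - (x\<^sup>2 / 2 + a\<^sup>2 / 2)" by (simp add: field_simps)
  have q: "nc_erlang_density n (a\<^sup>2 / 2) (x\<^sup>2 / 2) = (x\<^sup>2 / 2) ^ n * exp (- (x\<^sup>2 / 2 + a\<^sup>2 / 2)) *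
      (\<Sum>k. (a\<^sup>2 / 2 * (x\<^sup>2 / 2)) ^ k / (fact k * fact (k + n)))"
    using \<open>0 < x\<close> by (simp add: nc_erlang_density_def)
  show ?thesis unfolding q I e p[symmetric] by (simp only: mult_ac)
qed simp

text \<open>For \<open>l > 0\<close> the substitution \<open>t = x\<^sup>2 / 2\<close> maps the
  integration range onto \<open>{r..}\<close> and the Marcum integrand to the density;
  \<open>l = 0\<close> meets the separate clause of \<open>marcum_Q\<close>.\<close>

lemma marcum_Q_eq_tail:
  assumes l: "0 \<le> l" and r: "0 \<le> r"
  shows "marcum_Q (Suc n) (sqrt (2 * l)) (sqrt (2 * r)) = (LBINT t:{r..}. nc_erlang_density n l t)"
proof (cases "l = 0")
  case True
  \<comment> \<open>By \<open>0 ^ 0 = 1\<close> exactly the term \<open>k = 0\<close> of the series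
    survives.\<close>
  have "nc_erlang_density n 0 t = 1 / fact n * (t ^ n * exp (- t))" if "0 < t" for t
  proof -
    have "(\<Sum>k. (0 * t) ^ k / (fact k * fact (k + n))) = 1 / fact n"
      by (subst suminf_finite[of "{0}"]) auto
    then show ?thesis using that by (simp add: nc_erlang_density_def)
  qed
  then have "(LBINT t:{r..}. nc_erlang_density n 0 t) = (LBINT t:{r..}. 1 / fact n * (t ^ n * exp (- t)))"
    unfolding set_lebesgue_integral_def using r
    by (intro integral_cong_AE eventually_mono[OF AE_lborel_singleton[of 0]])
       (auto simp: indicator_def)
  then show ?thesis using True r by (simp add: marcum_Q_def)
next
  case False
  define a b where "a = sqrt (2 * l)" and "b = sqrt (2 * r)"
  let ?q = "nc_erlang_density n l"
  let ?g = "\<lambda>x::real. x\<^sup>2 / 2"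
  have a: "0 < a" "a\<^sup>2 / 2 = l" and b: "0 \<le> b" "b\<^sup>2 / 2 = r"
    using False l r by (auto simp: a_def b_def)
  \<comment> \<open>The change of variables rule speaks of Lebesgue integrability; for Borel
    functions this agrees with integrability over \<open>lborel\<close>.\<close>
  have lebesgue_iff: "f absolutely_integrable_on {c..} \<longleftrightarrow> set_integrable lborel {c..} f"
    if [measurable]: "f \<in> borel_measurable borel" for f :: "real \<Rightarrow> real" and c
    unfolding set_integrable_def by (rule integrable_completion) measurable
  have image: "?g ` {b..} = {r..}"
  proof (intro equalityI subsetI)
    fix y assume "y \<in> {r..}"
    then have "y = ?g (sqrt (2 * y))" "b \<le> sqrt (2 * y)" using r by (auto simp: b_def)
    then show "y \<in> ?g ` {b..}" by (intro image_eqI) auto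
  next
    fix y assume "y \<in> ?g ` {b..}"
    then show "y \<in> {r..}" using b by (auto intro!: divide_right_mono power_mono simp flip: b(2))
  qed
  have int_q: "set_integrable lborel {r..} ?q"
    using integrable_nc_erlang_density[OF l, of n] unfolding set_integrable_def
    by (intro integrable_mult_indicator) auto
  \<comment> \<open>The factor \<open>\<bar>x\<bar>\<close> is the absolute derivative of
    \<open>x\<^sup>2 / 2\<close>; it equals \<open>x\<close> on \<open>{b..}\<close> because
    \<open>0 \<le> b\<close>.\<close>
  have "(\<lambda>x. \<bar>x\<bar> * ?q (?g x)) absolutely_integrable_on {b..} \<and>
      integral {b..} (\<lambda>x. \<bar>x\<bar> * ?q (?g x)) = integral {r..} ?q"
    unfolding image[symmetric]
    using int_q b
    by (subst has_absolute_integral_change_of_variables_1')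
       (auto simp: image lebesgue_iff inj_on_def intro!: derivative_eq_intros)
  then have "(LBINT x:{b..}. \<bar>x\<bar> * ?q (?g x)) = (LBINT t:{r..}. ?q t)"
    using int_q by (simp add: lebesgue_iff set_borel_integral_eq_integral(2))
  moreover have "(LBINT x:{b..}. x * (x / a) ^ n * exp (- (x\<^sup>2 + a\<^sup>2) / 2) * bessel_I n (a * x))
     = (LBINT x:{b..}. \<bar>x\<bar> * ?q (?g x))"
  proof (intro set_lebesgue_integral_cong allI impI)
    fix x assume "x \<in> {b..}"
    then have "0 \<le> x" using b(1) by auto
    then show "x * (x / a) ^ n * exp (- (x\<^sup>2 + a\<^sup>2) / 2) * bessel_I n (a * x) = \<bar>x\<bar> * ?q (?g x)"
      by (simp only: marcum_integrand_eq[OF a(1)] a(2) abs_of_nonneg)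
  qed simp
  ultimately show ?thesis
    using a by (simp add: marcum_Q_def flip: a_def b_def)
qed

text \<open>The density has total mass 1, so the complement of its tail is its distribution
  function. The nonnegativity clause permits the return to real numbers, since
  \<open>ennreal\<close> sends every negative number to 0.\<close>

lemma one_minus_marcum_Q:
  assumes "1 \<le> N" "0 \<le> l" "0 \<le> r"
  shows "ennreal (1 - marcum_Q N (sqrt (2 * l)) (sqrt (2 * r)))
      = (\<integral>\<^sup>+t. nc_gamma_density (real N) l t * indicator {..r} t \<partial>lborel)"
    and "0 \<le> 1 - marcum_Q N (sqrt (2 * l)) (sqrt (2 * r))"
proof -
  obtain n where n: "N = Suc n" using assms(1) by (cases N) auto
  let ?q = "nc_erlang_density n l"
  have q: "integrable lborel ?q" by (rule integrable_nc_erlang_density[OF assms(2)])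
  have nonneg: "0 \<le> ?q t" for t by (rule nc_erlang_density_nonneg[OF assms(2)])
  have total: "(\<integral>t. ?q t \<partial>lborel) = 1"
    using nn_integral_nc_gamma_density[of "real N" l] assms
    by (subst integral_eq_nn_integral) (auto simp: nonneg n nc_gamma_density_Suc simp del: of_nat_Suc)
  have int: "set_integrable lborel A ?q" if "A \<in> sets borel" for A
    using q that unfolding set_integrable_def by (intro integrable_mult_indicator) auto
  \<comment> \<open>The two half-lines overlap only in the null set \<open>{r}\<close>.\<close>
  have "(\<integral>t. ?q t \<partial>lborel) = (\<integral>t. indicator {..r} t *\<^sub>R ?q t + indicator {r..} t *\<^sub>R ?q t \<partial>lborel)"
    by (intro integral_cong_AE eventually_mono[OF AE_lborel_singleton[of r]])
       (auto simp: indicator_def)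
  also have "\<dots> = (LBINT t:{..r}. ?q t) + (LBINT t:{r..}. ?q t)"
    using int[of "{..r}"] int[of "{r..}"] unfolding set_lebesgue_integral_def set_integrable_def
    by (intro Bochner_Integration.integral_add) auto
  finally have *: "1 - marcum_Q N (sqrt (2 * l)) (sqrt (2 * r)) = (LBINT t:{..r}. ?q t)"
    using total marcum_Q_eq_tail[OF assms(2,3), of n] by (simp add: n)
  show "0 \<le> 1 - marcum_Q N (sqrt (2 * l)) (sqrt (2 * r))"
    unfolding * set_lebesgue_integral_def by (intro integral_nonneg_AE) (auto simp: nonneg)
  have "ennreal (LBINT t:{..r}. ?q t) = (\<integral>\<^sup>+t. ennreal (indicator {..r} t *\<^sub>R ?q t) \<partial>lborel)"
    unfolding set_lebesgue_integral_def using int[of "{..r}"]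
    by (intro nn_integral_eq_integral[symmetric]) (auto simp: nonneg set_integrable_def)
  then show "ennreal (1 - marcum_Q N (sqrt (2 * l)) (sqrt (2 * r)))
      = (\<integral>\<^sup>+t. nc_gamma_density (real N) l t * indicator {..r} t \<partial>lborel)"
    unfolding * unfolding n nc_gamma_density_Suc[OF assms(2)]
    by (auto intro!: nn_integral_cong simp: indicator_def)
qed

section \<open>Conditioning on the shared Gaussian variables\<close>

text \<open>An injective renaming carries finite index sets to finite index sets without merging
  factors, so the product formula transfers. It serves to fix \<open>m\<close> in families indexed
  by pairs \<open>(m, j)\<close> and to pass from tagged pairs to such pairs.\<close>

lemma (in prob_space) indep_vars_reindex_inj:
  assumes indep: "indep_vars N X (f ` I)" and inj: "inj_on f I"
  shows "indep_vars (\<lambda>i. N (f i)) (\<lambda>i. X (f i)) I"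
  unfolding indep_vars_def2
proof
  show "\<forall>i\<in>I. X (f i) \<in> measurable M (N (f i))"
    using indep by (auto simp: indep_vars_def2)
  show "indep_sets (\<lambda>i. {X (f i) -` A \<inter> space M |A. A \<in> sets (N (f i))}) I"
  proof (rule indep_setsI)
    fix B J assume J: "J \<noteq> {}" "J \<subseteq> I" "finite J"
      and B: "\<forall>j\<in>J. B j \<in> {X (f j) -` A \<inter> space M |A. A \<in> sets (N (f j))}"
    have inv: "the_inv_into I f (f j) = j" if "j \<in> J" for j
      using that J inj by (auto intro: the_inv_into_f_f)
    have "prob (\<Inter>i\<in>f ` J. B (the_inv_into I f i)) = (\<Prod>i\<in>f ` J. prob (B (the_inv_into I f i)))"
      using indep J B inv by (intro indep_setsD) (auto simp: indep_vars_def2)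
    also have "\<dots> = (\<Prod>j\<in>J. prob (B j))"
      using inj_on_subset[OF inj J(2)] inv by (subst prod.reindex) (auto cong: prod.cong)
    finally show "prob (\<Inter>j\<in>J. B j) = (\<Prod>j\<in>J. prob (B j))"
      using inv by (simp add: image_image cong: INF_cong)
  qed (use indep in \<open>auto simp: indep_vars_def2\<close>)
qed

text \<open>Row \<open>m0\<close> is shared by all the others. With it frozen, the rows in
  \<open>A\<close> give independent sums of shifted squares whose law depends only on
  \<open>s\<close>, the sum of squares of row \<open>m0\<close>. Each contributes the same factor,
  hence the power \<open>card A\<close>; the outer integral averages over the law of
  \<open>s\<close>.\<close>

lemma (in prob_space) prob_conditioned_on_common:
  fixes Z :: "'m \<times> 'j \<Rightarrow> 'a \<Rightarrow> real"
  assumes fin: "finite A" "finite J" "J \<noteq> {}" and m0: "m0 \<notin> A"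
    and indep: "indep_vars (\<lambda>_. borel) Z (insert m0 A \<times> J)"
    and normal: "\<And>m j. m \<in> insert m0 A \<Longrightarrow> j \<in> J \<Longrightarrow> distributed M lborel (Z (m, j)) (normal_density 0 (sqrt (1 / 2)))"
  shows "emeasure M {\<omega> \<in> space M. (\<Sum>j\<in>J. (Z (m0, j) \<omega>)\<^sup>2) \<le> r0 \<and> (\<forall>m\<in>A. (\<Sum>j\<in>J. (Z (m, j) \<omega> + \<kappa> * Z (m0, j) \<omega>)\<^sup>2) \<le> r)}
    = (\<integral>\<^sup>+s. nc_gamma_density (real (card J) / 2) 0 s * (indicator {..r0} s *
        (\<integral>\<^sup>+t. nc_gamma_density (real (card J) / 2) (\<kappa>\<^sup>2 * s) t * indicator {..r} t \<partial>lborel) ^ card A) \<partial>lborel)"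
proof -
  define F where "F l = (\<integral>\<^sup>+t. nc_gamma_density (real (card J) / 2) l t * indicator {..r} t \<partial>lborel)" for l
  have [measurable]: "F \<in> borel_measurable borel" unfolding F_def by measurable
  define K0 where "K0 = {m0} \<times> J"
  define K1 where "K1 = A \<times> J"
  have rv [measurable]: "Z (m, j) \<in> borel_measurable M" if "m \<in> insert m0 A" "j \<in> J" for m j
    using distributed_measurable[OF normal[OF that]] by simp
  let ?S = "Pi\<^sub>M K0 (\<lambda>_. borel :: real measure)" and ?T = "Pi\<^sub>M K1 (\<lambda>_. borel :: real measure)"
  define U where "U \<omega> = restrict (\<lambda>i. Z i \<omega>) K0" for \<omega>
  define V where "V \<omega> = restrict (\<lambda>i. Z i \<omega>) K1" for \<omega>
  have indepUV: "indep_var ?S U ?T V"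
    unfolding U_def V_def K0_def K1_def using m0 by (intro indep_var_restrict[OF indep]) auto
  have U [measurable]: "U \<in> measurable M ?S" and V [measurable]: "V \<in> measurable M ?T"
    using indepUV by (auto dest: indep_var_rv1 indep_var_rv2)
  have joint: "distr M ?S U \<Otimes>\<^sub>M distr M ?T V = distr M (?S \<Otimes>\<^sub>M ?T) (\<lambda>\<omega>. (U \<omega>, V \<omega>))"
    using indepUV by (simp add: indep_var_distribution_eq)
  interpret V: prob_space "distr M ?T V" by (rule prob_space_distr) measurable
  \<comment> \<open>Independence makes the joint law of \<open>U\<close> and \<open>V\<close> a
    product. Expressing the event as a set in the product space reduces its probability to the
    sections at each value \<open>u\<close> of the shared row.\<close>
  define E where "E = {p \<in> space (?S \<Otimes>\<^sub>M ?T). (\<Sum>j\<in>J. (fst p (m0, j))\<^sup>2) \<le> r0 \<and>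
      (\<forall>m\<in>A. (\<Sum>j\<in>J. (snd p (m, j) + \<kappa> * fst p (m0, j))\<^sup>2) \<le> r)}"
  have [measurable]: "(\<lambda>u. u (m0, j)) \<in> borel_measurable ?S" if "j \<in> J" for j
    using that unfolding K0_def by (intro measurable_component_singleton) auto
  have [measurable]: "(\<lambda>v. v (m, j)) \<in> borel_measurable ?T" if "m \<in> A" "j \<in> J" for m j
    using that unfolding K1_def by (intro measurable_component_singleton) auto
  have E [measurable]: "E \<in> sets (?S \<Otimes>\<^sub>M ?T)"
    unfolding E_def using fin by measurable
  have slice: "emeasure (distr M ?T V) (Pair u -` E) = indicator {..r0} (\<Sum>j\<in>J. (u (m0, j))\<^sup>2) * F (\<kappa>\<^sup>2 * (\<Sum>j\<in>J. (u (m0, j))\<^sup>2)) ^ card A"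
    if u: "u \<in> space ?S" for u
  proof -
    define Y where "Y m \<omega> = (\<Sum>j\<in>J. (Z (m, j) \<omega> + \<kappa> * u (m0, j))\<^sup>2)" for m \<omega>
    have rvY: "Y m \<in> borel_measurable M" if "m \<in> A" for m using that unfolding Y_def
      by (intro borel_measurable_sum borel_measurable_power borel_measurable_add) (auto intro: rv)
    have "emeasure (distr M ?T V) (Pair u -` E) = emeasure M (V -` (Pair u -` E) \<inter> space M)"
      using sets_Pair1[OF E] by (intro emeasure_distr) measurable
    also have "V -` (Pair u -` E) \<inter> space M =
       (if (\<Sum>j\<in>J. (u (m0, j))\<^sup>2) \<le> r0 then {\<omega> \<in> space M. \<forall>m\<in>A. Y m \<omega> \<le> r} else {})"
      using u measurable_space[OF V] by (auto simp: E_def Y_def V_def K1_def space_pair_measure cong: sum.cong)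
    also have "emeasure M \<dots> = indicator {..r0} (\<Sum>j\<in>J. (u (m0, j))\<^sup>2) * emeasure M {\<omega> \<in> space M. \<forall>m\<in>A. Y m \<omega> \<le> r}"
      by (simp add: indicator_def)
    also have "emeasure M {\<omega> \<in> space M. \<forall>m\<in>A. Y m \<omega> \<le> r} = (\<Prod>m\<in>A. emeasure M {\<omega> \<in> space M. Y m \<omega> \<le> r})"
    \<comment> \<open>The empty case occurs for a single channel; the product rule for finitely many
      independent events asks for a nonempty index set.\<close>
    proof (cases "A = {}")
      case True
      then show ?thesis by (simp add: emeasure_space_1)
    next
      case False
      \<comment> \<open>Different rows occupy disjoint blocks of index pairs, so functions of
        different rows are independent.\<close>
      have "indep_vars (\<lambda>m. Pi\<^sub>M ({m} \<times> J) (\<lambda>_. borel)) (\<lambda>m \<omega>. restrict (\<lambda>i. Z i \<omega>) ({m} \<times> J)) A"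
        by (intro indep_vars_restrict[OF indep]) (auto simp: disjoint_family_on_def)
      then have "indep_vars (\<lambda>_. borel) (\<lambda>m \<omega>. (\<lambda>v. \<Sum>j\<in>J. (v (m, j) + \<kappa> * u (m0, j))\<^sup>2) (restrict (\<lambda>i. Z i \<omega>) ({m} \<times> J))) A"
        by (rule indep_vars_compose2) (intro borel_measurable_sum borel_measurable_power borel_measurable_add measurable_component_singleton, auto)
      then have "indep_vars (\<lambda>_. borel) Y A"
        by (rule iffD1[OF indep_vars_cong, rotated 3]) (auto simp: Y_def cong: sum.cong)
      then have "prob (\<Inter>m\<in>A. Y m -` {..r} \<inter> space M) = (\<Prod>m\<in>A. prob (Y m -` {..r} \<inter> space M))"
        using False fin by (intro indep_varsD_finite) auto
      moreover have "(\<Inter>m\<in>A. Y m -` {..r} \<inter> space M) = {\<omega> \<in> space M. \<forall>m\<in>A. Y m \<omega> \<le> r}"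
        "Y m -` {..r} \<inter> space M = {\<omega> \<in> space M. Y m \<omega> \<le> r}" for m using False by auto
      ultimately show ?thesis by (simp add: emeasure_eq_measure prod_ennreal)
    qed
    also have "(\<Prod>m\<in>A. emeasure M {\<omega> \<in> space M. Y m \<omega> \<le> r}) = (\<Prod>m\<in>A. F (\<kappa>\<^sup>2 * (\<Sum>j\<in>J. (u (m0, j))\<^sup>2)))"
    proof (rule prod.cong[OF refl])
      fix m assume m: "m \<in> A"
      have "indep_vars (\<lambda>_. borel) Z (Pair m ` J)" 
        using m by (intro indep_vars_subset[OF indep]) auto
      then have "indep_vars (\<lambda>_. borel) (\<lambda>j. Z (m, j)) J"
        by (rule indep_vars_reindex_inj) (auto simp: inj_on_def)
      then have D: "distributed M lborel (Y m) (nc_gamma_density (real (card J) / 2) (\<Sum>j\<in>J. (\<kappa> * u (m0, j))\<^sup>2))"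
        unfolding Y_def using m fin normal by (intro distributed_sum_normal_shift_square) auto
      have "{\<omega> \<in> space M. Y m \<omega> \<le> r} = Y m -` {..r} \<inter> space M" by auto
      then show "emeasure M {\<omega> \<in> space M. Y m \<omega> \<le> r} = F (\<kappa>\<^sup>2 * (\<Sum>j\<in>J. (u (m0, j))\<^sup>2))"
        unfolding F_def by (simp add: distributed_emeasure[OF D] power_mult_distrib sum_distrib_left)
    qed
    finally show ?thesis by simp
  qed
  have indep0: "indep_vars (\<lambda>_. borel) (\<lambda>j. Z (m0, j)) J"
    by (rule indep_vars_reindex_inj, rule indep_vars_subset[OF indep]) (auto simp: inj_on_def)
  have D0: "distributed M lborel (\<lambda>\<omega>. \<Sum>j\<in>J. (Z (m0, j) \<omega>)\<^sup>2) (nc_gamma_density (real (card J) / 2) 0)"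
    using distributed_sum_normal_shift_square[OF fin(2,3) indep0, of "\<lambda>_. 0"] normal by simp
  have "{\<omega> \<in> space M. (\<Sum>j\<in>J. (Z (m0, j) \<omega>)\<^sup>2) \<le> r0 \<and> (\<forall>m\<in>A. (\<Sum>j\<in>J. (Z (m, j) \<omega> + \<kappa> * Z (m0, j) \<omega>)\<^sup>2) \<le> r)}
    = (\<lambda>\<omega>. (U \<omega>, V \<omega>)) -` E \<inter> space M"
    using measurable_space[OF U] measurable_space[OF V]
    by (auto simp: E_def U_def V_def K0_def K1_def space_pair_measure cong: sum.cong)
  then have "emeasure M {\<omega> \<in> space M. (\<Sum>j\<in>J. (Z (m0, j) \<omega>)\<^sup>2) \<le> r0 \<and> (\<forall>m\<in>A. (\<Sum>j\<in>J. (Z (m, j) \<omega> + \<kappa> * Z (m0, j) \<omega>)\<^sup>2) \<le> r)}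
    = emeasure (distr M ?S U \<Otimes>\<^sub>M distr M ?T V) E"
    unfolding joint by (subst emeasure_distr) simp_all
  also have "\<dots> = (\<integral>\<^sup>+u. emeasure (distr M ?T V) (Pair u -` E) \<partial>distr M ?S U)"
    by (intro V.emeasure_pair_measure_alt) simp
  also have "\<dots> = (\<integral>\<^sup>+u. indicator {..r0} (\<Sum>j\<in>J. (u (m0, j))\<^sup>2) * F (\<kappa>\<^sup>2 * (\<Sum>j\<in>J. (u (m0, j))\<^sup>2)) ^ card A \<partial>distr M ?S U)"
    by (intro nn_integral_cong slice) simp
  also have "\<dots> = (\<integral>\<^sup>+\<omega>. indicator {..r0} (\<Sum>j\<in>J. (U \<omega> (m0, j))\<^sup>2) * F (\<kappa>\<^sup>2 * (\<Sum>j\<in>J. (U \<omega> (m0, j))\<^sup>2)) ^ card A \<partial>M)"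
    by (intro nn_integral_distr) measurable
  also have "\<dots> = (\<integral>\<^sup>+\<omega>. indicator {..r0} (\<Sum>j\<in>J. (Z (m0, j) \<omega>)\<^sup>2) * F (\<kappa>\<^sup>2 * (\<Sum>j\<in>J. (Z (m0, j) \<omega>)\<^sup>2)) ^ card A \<partial>M)"
    by (simp add: U_def K0_def cong: sum.cong)
  \<comment> \<open>The integrand depends on the shared row only through its sum of squares, so the
    density of that sum can be used.\<close>
  also have "\<dots> = (\<integral>\<^sup>+s. nc_gamma_density (real (card J) / 2) 0 s * (indicator {..r0} s * F (\<kappa>\<^sup>2 * s) ^ card A) \<partial>lborel)"
    by (subst distributed_nn_integral[OF D0, symmetric]) auto
  finally show ?thesis unfolding F_def .
qed

section \<open>The channel gains and the final integral\<close>

theorem lemma2: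
  fixes P :: "'a measure"
    and x y :: "nat \<Rightarrow> nat \<Rightarrow> 'a \<Rightarrow> real"
    and N M :: nat
    and \<sigma> \<rho> z :: real
  assumes "prob_space P"
    and "N \<ge> 1" and "M \<ge> 1"
    and "\<sigma> > 0" and "\<bar>\<rho>\<bar> < 1"
    and "prob_space.indep_vars P (\<lambda>_. borel)
           (case_sum (\<lambda>(m, n). x m n) (\<lambda>(m, n). y m n))
           (({0} \<union> {2..M}) \<times> {1..N} <+> ({0} \<union> {2..M}) \<times> {1..N})"
    and "\<And>m n. m \<in> {0} \<union> {2..M} \<Longrightarrow> n \<in> {1..N} \<Longrightarrow>
           distributed P lborel (x m n) (normal_density 0 (sqrt (1 / 2)))"
    and "\<And>m n. m \<in> {0} \<union> {2..M} \<Longrightarrow> n \<in> {1..N} \<Longrightarrow>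
           distributed P lborel (y m n) (normal_density 0 (sqrt (1 / 2)))"
    and "z \<ge> 0"
  shows "\<P>(\<omega> in P. \<forall>m\<in>{1..M}. channel_gain N \<sigma> \<rho> x y m \<omega> \<le> z) =
         (LBINT t:{0..z}. t ^ (N - 1) / (\<sigma> ^ (2 * N) * fact (N - 1)) * exp (- t / \<sigma>\<^sup>2)
            * (1 - marcum_Q N (sqrt (2 * \<rho>\<^sup>2 * t / (\<sigma>\<^sup>2 * (1 - \<rho>\<^sup>2))))
                              (sqrt (2 * z / (\<sigma>\<^sup>2 * (1 - \<rho>\<^sup>2))))) ^ (M - 1))"
proof -
  interpret prob_space P by fact
  \<comment> \<open>\<open>J\<close> lists the \<open>2 * N\<close> real coordinates of one channel
    row, with \<open>Inl\<close> for real and \<open>Inr\<close> for imaginary parts;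
    \<open>e\<close> moves this tag outwards to match the index set of the independence
    hypothesis.\<close>
  define J where "J = {1..N} <+> {1..N}"
  define e :: "nat \<times> (nat + nat) \<Rightarrow> nat \<times> nat + nat \<times> nat"
    where "e = (\<lambda>(m, j). case j of Inl n \<Rightarrow> Inl (m, n) | Inr n \<Rightarrow> Inr (m, n))"
  define Z where "Z i = case_sum (\<lambda>(m, n). x m n) (\<lambda>(m, n). y m n) (e i)" for i
  \<comment> \<open>These constants satisfy \<open>sqrt \<tau> * u + \<rho> * v = sqrt \<tau> * (u +
    \<kappa> * v)\<close>, which makes each gain with \<open>m \<ge> 2\<close> equal to
    \<open>\<sigma>\<^sup>2 * \<tau>\<close> times a sum of shifted squares.\<close>
  define \<tau> where "\<tau> = 1 - \<rho>\<^sup>2"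
  define \<kappa> where "\<kappa> = \<rho> / sqrt \<tau>"
  have \<tau>: "0 < \<tau>" using assms(5) by (simp add: \<tau>_def abs_square_less_1)
  have \<kappa>: "\<kappa>\<^sup>2 = \<rho>\<^sup>2 / \<tau>" using \<tau> by (simp add: \<kappa>_def power_divide)
  have Z: "Z (m, Inl n) = x m n" "Z (m, Inr n) = y m n" for m n by (simp_all add: Z_def e_def)
  have sum_J: "(\<Sum>j\<in>J. g j) = (\<Sum>n=1..N. g (Inl n) + g (Inr n))" for g :: "nat + nat \<Rightarrow> real"
    unfolding J_def by (subst sum.Plus) (simp_all add: sum.distrib)
  have e_image: "e ` (insert 0 {2..M} \<times> J) = (({0} \<union> {2..M}) \<times> {1..N} <+> ({0} \<union> {2..M}) \<times> {1..N})"
    (is "_ = ?I")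
  proof (intro equalityI subsetI)
    fix i assume "i \<in> ?I"
    then consider m n where "i = e (m, Inl n)" "m \<in> insert 0 {2..M}" "n \<in> {1..N}"
      | m n where "i = e (m, Inr n)" "m \<in> insert 0 {2..M}" "n \<in> {1..N}"
      by (auto simp: e_def)
    then show "i \<in> e ` (insert 0 {2..M} \<times> J)"
      by cases (auto simp: J_def)
  qed (auto simp: e_def J_def)
  have inj_e: "inj_on e (insert 0 {2..M} \<times> J)"
    by (rule inj_on_inverseI[where g="case_sum (\<lambda>(m, n). (m, Inl n)) (\<lambda>(m, n). (m, Inr n))"])
       (auto simp: e_def split: sum.splits)
  have indep: "indep_vars (\<lambda>_. borel) Z (insert 0 {2..M} \<times> J)"
    using indep_vars_reindex_inj[OF assms(6)[folded e_image] inj_e] by (simp only: Z_def[abs_def])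
  have normal: "distributed P lborel (Z (m, j)) (normal_density 0 (sqrt (1 / 2)))"
    if "m \<in> insert 0 {2..M}" "j \<in> J" for m j
    using that assms(7)[of m] assms(8)[of m] by (auto simp: J_def Z)
  have gain1: "channel_gain N \<sigma> \<rho> x y 1 \<omega> = \<sigma>\<^sup>2 * (\<Sum>j\<in>J. (Z (0, j) \<omega>)\<^sup>2)" for \<omega>
    unfolding channel_gain_def sum_J sum_distrib_left
    by (intro sum.cong refl) (simp add: channel_def cmod_power2 Z power_mult_distrib algebra_simps)
  have gain: "channel_gain N \<sigma> \<rho> x y m \<omega> = \<sigma>\<^sup>2 * \<tau> * (\<Sum>j\<in>J. (Z (m, j) \<omega> + \<kappa> * Z (0, j) \<omega>)\<^sup>2)"
    if "m \<in> {2..M}" for m \<omega>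
  proof -
    have *: "(\<sigma> * (sqrt \<tau> * u + \<rho> * v))\<^sup>2 = \<sigma>\<^sup>2 * \<tau> * (u + \<kappa> * v)\<^sup>2" for u v
    proof -
      have "sqrt \<tau> * u + \<rho> * v = sqrt \<tau> * (u + \<kappa> * v)"
        using \<tau> by (simp add: \<kappa>_def field_simps)
      then show ?thesis using \<tau> by (simp add: power_mult_distrib)
    qed
    have "(cmod (channel \<sigma> \<rho> x y m n \<omega>))\<^sup>2
        = \<sigma>\<^sup>2 * \<tau> * (x m n \<omega> + \<kappa> * x 0 n \<omega>)\<^sup>2 + \<sigma>\<^sup>2 * \<tau> * (y m n \<omega> + \<kappa> * y 0 n \<omega>)\<^sup>2" for n
      unfolding *[symmetric] using that by (simp add: channel_def cmod_power2 \<tau>_def)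
    then show ?thesis
      unfolding channel_gain_def sum_J sum_distrib_left by (simp only: Z distrib_left)
  qed
  define F where "F l = (\<integral>\<^sup>+t. nc_gamma_density (real N) l t * indicator {..z / (\<sigma>\<^sup>2 * \<tau>)} t \<partial>lborel)" for l
  have [measurable]: "F \<in> borel_measurable borel" unfolding F_def by measurable
  \<comment> \<open>The claimed integrand with \<open>F\<close> in place of the Marcum expression:
    measurability and sign are then immediate, and the two agree on \<open>{0..z}\<close>.\<close>
  define H where "H t = indicator {0..z} t * (t ^ (N - 1) / (\<sigma> ^ (2 * N) * fact (N - 1)) * exp (- t / \<sigma>\<^sup>2)
      * enn2real (F (\<kappa>\<^sup>2 * (t / \<sigma>\<^sup>2))) ^ (M - 1))" for t
  have [measurable]: "H \<in> borel_measurable borel" unfolding H_def by measurable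
  have H_nonneg: "0 \<le> H t" for t using assms(4) by (auto simp: H_def indicator_def)
  have r: "0 \<le> z / (\<sigma>\<^sup>2 * \<tau>)" using assms(9) \<tau> by simp
  have F: "F (\<kappa>\<^sup>2 * (t / \<sigma>\<^sup>2)) = ennreal (1 - marcum_Q N (sqrt (2 * \<rho>\<^sup>2 * t / (\<sigma>\<^sup>2 * \<tau>))) (sqrt (2 * z / (\<sigma>\<^sup>2 * \<tau>))))"
    "0 \<le> 1 - marcum_Q N (sqrt (2 * \<rho>\<^sup>2 * t / (\<sigma>\<^sup>2 * \<tau>))) (sqrt (2 * z / (\<sigma>\<^sup>2 * \<tau>)))" if "0 \<le> t" for t
  proof -
    have 1: "0 \<le> \<kappa>\<^sup>2 * (t / \<sigma>\<^sup>2)" using that by simp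
    have 2: "2 * \<rho>\<^sup>2 * t / (\<sigma>\<^sup>2 * \<tau>) = 2 * (\<kappa>\<^sup>2 * (t / \<sigma>\<^sup>2))" "2 * z / (\<sigma>\<^sup>2 * \<tau>) = 2 * (z / (\<sigma>\<^sup>2 * \<tau>))"
      by (simp_all add: \<kappa> mult_ac)
    show "F (\<kappa>\<^sup>2 * (t / \<sigma>\<^sup>2)) = ennreal (1 - marcum_Q N (sqrt (2 * \<rho>\<^sup>2 * t / (\<sigma>\<^sup>2 * \<tau>))) (sqrt (2 * z / (\<sigma>\<^sup>2 * \<tau>))))"
      "0 \<le> 1 - marcum_Q N (sqrt (2 * \<rho>\<^sup>2 * t / (\<sigma>\<^sup>2 * \<tau>))) (sqrt (2 * z / (\<sigma>\<^sup>2 * \<tau>)))"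
      unfolding 2 F_def using one_minus_marcum_Q[OF assms(2) 1 r] by simp_all
  qed
  have "{\<omega> \<in> space P. \<forall>m\<in>{1..M}. channel_gain N \<sigma> \<rho> x y m \<omega> \<le> z}
    = {\<omega> \<in> space P. (\<Sum>j\<in>J. (Z (0, j) \<omega>)\<^sup>2) \<le> z / \<sigma>\<^sup>2 \<and>
        (\<forall>m\<in>{2..M}. (\<Sum>j\<in>J. (Z (m, j) \<omega> + \<kappa> * Z (0, j) \<omega>)\<^sup>2) \<le> z / (\<sigma>\<^sup>2 * \<tau>))}"
  proof -
    have "{1..M} = insert 1 {2..M}" using assms(3) by auto
    moreover have "\<sigma>\<^sup>2 * s \<le> z \<longleftrightarrow> s \<le> z / \<sigma>\<^sup>2" "\<sigma>\<^sup>2 * \<tau> * s \<le> z \<longleftrightarrow> s \<le> z / (\<sigma>\<^sup>2 * \<tau>)" for s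
      using assms(4) \<tau> by (simp_all add: pos_le_divide_eq mult.commute)
    ultimately show ?thesis by (simp add: gain1[unfolded One_nat_def] gain)
  qed
  moreover have "card J = 2 * N" unfolding J_def by (simp add: card_Plus)
  \<comment> \<open>The shared row is \<open>m0 = 0\<close>. The set \<open>{2..M}\<close> supplies
    the exponent \<open>M - 1\<close>, and half of \<open>card J\<close> is the shape
    \<open>N\<close>.\<close>
  ultimately have "emeasure P {\<omega> \<in> space P. \<forall>m\<in>{1..M}. channel_gain N \<sigma> \<rho> x y m \<omega> \<le> z}
     = (\<integral>\<^sup>+s. nc_gamma_density (real N) 0 s * (indicator {..z / \<sigma>\<^sup>2} s * F (\<kappa>\<^sup>2 * s) ^ (M - 1)) \<partial>lborel)"
    using assms(2) prob_conditioned_on_common[OF _ _ _ _ indep normal, of "z / \<sigma>\<^sup>2" \<kappa> "z / (\<sigma>\<^sup>2 * \<tau>)"]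
    by (simp add: F_def J_def)
  \<comment> \<open>Substituting \<open>s = t / \<sigma>\<^sup>2\<close> makes the integration
    variable the value of the first gain itself.\<close>
  also have "\<dots> = ennreal (1 / \<sigma>\<^sup>2) * (\<integral>\<^sup>+t. nc_gamma_density (real N) 0 (t / \<sigma>\<^sup>2) * (indicator {..z / \<sigma>\<^sup>2} (t / \<sigma>\<^sup>2) * F (\<kappa>\<^sup>2 * (t / \<sigma>\<^sup>2)) ^ (M - 1)) \<partial>lborel)"
    using assms(4) by (subst nn_integral_real_affine[where c="1 / \<sigma>\<^sup>2" and t=0]) simp_all
  also have "\<dots> = (\<integral>\<^sup>+t. ennreal (1 / \<sigma>\<^sup>2) * (nc_gamma_density (real N) 0 (t / \<sigma>\<^sup>2) * (indicator {..z / \<sigma>\<^sup>2} (t / \<sigma>\<^sup>2) * F (\<kappa>\<^sup>2 * (t / \<sigma>\<^sup>2)) ^ (M - 1))) \<partial>lborel)"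
    by (subst nn_integral_cmult) simp_all
  also have "\<dots> = (\<integral>\<^sup>+t. ennreal (H t) \<partial>lborel)"
  \<comment> \<open>The point 0 is dropped because \<open>gamma_density\<close> is 0 there by
    definition, whereas for \<open>N = 1\<close> the factor \<open>t ^ (N - 1)\<close> in
    \<open>H\<close> is 1 at 0.\<close>
  proof (intro nn_integral_cong_AE eventually_mono[OF AE_lborel_singleton[of 0]])
    fix t :: real assume "t \<noteq> 0"
    show "ennreal (1 / \<sigma>\<^sup>2) * (nc_gamma_density (real N) 0 (t / \<sigma>\<^sup>2) * (indicator {..z / \<sigma>\<^sup>2} (t / \<sigma>\<^sup>2) * F (\<kappa>\<^sup>2 * (t / \<sigma>\<^sup>2)) ^ (M - 1))) = ennreal (H t)"
    proof (cases "0 < t \<and> t \<le> z")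
      case True
      obtain n where n: "N = Suc n" using assms(2) by (cases N) auto
      have g: "gamma_density (real N) (t / \<sigma>\<^sup>2) = (t / \<sigma>\<^sup>2) ^ n * exp (- (t / \<sigma>\<^sup>2)) / fact n"
        using True assms(4) Gamma_fact[of n, where 'a=real] by (simp add: gamma_density_def n powr_realpow add.commute)
      define q where "q = 1 - marcum_Q N (sqrt (2 * \<rho>\<^sup>2 * t / (\<sigma>\<^sup>2 * \<tau>))) (sqrt (2 * z / (\<sigma>\<^sup>2 * \<tau>)))"
      have q: "F (\<kappa>\<^sup>2 * (t / \<sigma>\<^sup>2)) = ennreal q" "0 \<le> q" using F[of t] True by (auto simp: q_def)
      have H: "1 / \<sigma>\<^sup>2 * (gamma_density (real N) (t / \<sigma>\<^sup>2) * q ^ (M - 1)) = H t"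
        unfolding H_def g q(1) using True q(2) assms(4)
        by (simp add: n power_divide power_mult[symmetric] mult.commute[of 2] field_simps flip: power_mult)
          (simp add: power_mult power2_eq_square power_mult_distrib)
      have ind: "indicator {..z / \<sigma>\<^sup>2} (t / \<sigma>\<^sup>2) = (1 :: ennreal)"
        using True assms(4) by (simp add: divide_right_mono)
      have "0 \<le> gamma_density (real N) (t / \<sigma>\<^sup>2)" using assms(2) by (intro gamma_density_nonneg) simp
      then have "ennreal (H t) = ennreal (1 / \<sigma>\<^sup>2) * (ennreal (gamma_density (real N) (t / \<sigma>\<^sup>2)) * ennreal (q ^ (M - 1)))"
        unfolding H[symmetric] by (simp only: ennreal_mult' zero_le_divide_1_iff zero_le_power2)
      then show ?thesis by (simp only: ind q(1) nc_gamma_density_0 ennreal_power[OF q(2)] mult_1_left)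
    next
      case False
      then have "t < 0 \<or> z < t" using \<open>t \<noteq> 0\<close> by auto
      then show ?thesis
      proof
        assume "t < 0"
        then show ?thesis
          by (simp add: nc_gamma_density_0 gamma_density_def H_def zero_less_divide_iff)
      next
        assume "z < t"
        then show ?thesis
          using assms(4) by (simp add: H_def divide_le_cancel)
      qed
    qed
  qed
  finally have "\<P>(\<omega> in P. \<forall>m\<in>{1..M}. channel_gain N \<sigma> \<rho> x y m \<omega> \<le> z) = (\<integral>t. H t \<partial>lborel)"
    by (simp add: measure_def integral_eq_nn_integral H_nonneg)
  also have "\<dots> = (LBINT t:{0..z}. t ^ (N - 1) / (\<sigma> ^ (2 * N) * fact (N - 1)) * exp (- t / \<sigma>\<^sup>2)
            * (1 - marcum_Q N (sqrt (2 * \<rho>\<^sup>2 * t / (\<sigma>\<^sup>2 * (1 - \<rho>\<^sup>2))))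
                              (sqrt (2 * z / (\<sigma>\<^sup>2 * (1 - \<rho>\<^sup>2))))) ^ (M - 1))"
    unfolding set_lebesgue_integral_def \<tau>_def[symmetric]
  proof (intro Bochner_Integration.integral_cong refl)
    fix t
    have "enn2real (F (\<kappa>\<^sup>2 * (t / \<sigma>\<^sup>2))) = 1 - marcum_Q N (sqrt (2 * \<rho>\<^sup>2 * t / (\<sigma>\<^sup>2 * \<tau>))) (sqrt (2 * z / (\<sigma>\<^sup>2 * \<tau>)))"
      if "0 \<le> t"
      unfolding F(1)[OF that] using F(2)[OF that] by (rule enn2real_ennreal)
    then show "H t = indicat_real {0..z} t *\<^sub>R (t ^ (N - 1) / (\<sigma> ^ (2 * N) * fact (N - 1)) * exp (- t / \<sigma>\<^sup>2)
            * (1 - marcum_Q N (sqrt (2 * \<rho>\<^sup>2 * t / (\<sigma>\<^sup>2 * \<tau>))) (sqrt (2 * z / (\<sigma>\<^sup>2 * \<tau>)))) ^ (M - 1))"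
      unfolding H_def by (cases "t \<in> {0..z}") simp_all
  qed
  finally show ?thesis .
qed

end
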